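(* Let $m\ge 2$, let $D_1,\dots,D_m$ be propositional clauses (not necessarily distinct), and let $x_1,\dots,x_{m-1}$ be literals. Suppose that for each $i$ a sub-clause $D_i^-\subseteq D_i$ is given with $D_1^-=\{x_1\}$; $D_i^-=\{x_i,\neg x_{i-1}\}\cup D^i$ for $2\le i\le m-1$; and $D_m^-=\{\neg x_{m-1}\}\cup D^m$, where $D^2=\emptyset$ and $D^j\subseteq\{\neg x_1,\dots,\neg x_{j-2}\}$ for $3\le j\le m$. Then the contradiction based on standard extension $\bigwedge_{i=1}^m D_i^-$ is a standard contradiction; that is, for every tuple $(p_1,\dots,p_m)$ with $p_i\in D_i^-$ for all $i$, there exist indices $i,j$ such that $p_i$ and $p_j$ are complementary.
   Context: Propositional logic. A literal is a propositional variable $p$ or its negation $\neg p$; $p$ and $\neg p$ form a complementary pair (and $\neg\neg p$ is identified with $p$). A clause is a finite disjunction of literals, identified with the finite set of its literals. A finite list of clauses $E_1,\dots,E_m$ (conjunction $\bigwedge_{i=1}^m E_i$) is called a standard contradiction if for every $(p_1,\dots,p_m)\in E_1\times\cdots\times E_m$ there is at least one complementary pair among $p_1,\dots,p_m$. The conjunction $\bigwedge_{i=1}^m D_i^-$ built as in the claim is called a contradiction based on standard extension of $D_1,\dots,D_m$. *)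

theory Defs
  imports Main "HOL-Library.FuncSet"
begin

datatype 'v literal = Pos 'v | Neg 'v

text \<open>Negation of literals: \<open>\<not>\<not>p\<close> is identified with \<open>p\<close>.\<close>

fun neg :: "'v literal \<Rightarrow> 'v literal" where
  "neg (Pos p) = Neg p"
| "neg (Neg p) = Pos p"

definition complementary :: "'v literal \<Rightarrow> 'v literal \<Rightarrow> bool" where
  "complementary l l' \<longleftrightarrow> (\<exists>v. {l, l'} = {Pos v, Neg v})"

definition clause :: "'v literal set \<Rightarrow> bool" where
  "clause C \<longleftrightarrow> finite C"

text \<open>A list of clauses \<open>E\<^sub>1, \<dots>, E\<^sub>m\<close> is a family \<open>E\<close>, of which only the values on
  \<open>{1..m}\<close> matter; repetitions are allowed.\<close>

definition standard_contradiction :: "nat \<Rightarrow> (nat \<Rightarrow> 'v literal set) \<Rightarrow> bool" where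
  "standard_contradiction m E \<longleftrightarrow>
     (\<forall>i\<in>{1..m}. clause (E i)) \<and>
     (\<forall>p \<in> (\<Pi>\<^sub>E i\<in>{1..m}. E i). \<exists>i\<in>{1..m}. \<exists>j\<in>{1..m}. complementary (p i) (p j))"

text \<open>\<open>E i\<close> is the sub-clause \<open>D\<^sub>i\<^sup>-\<close> of \<open>D\<^sub>i\<close>, and \<open>U i\<close> is the set written \<open>D\<^sup>i\<close>
  (with upper index), which is only used for \<open>2 \<le> i \<le> m\<close>.\<close>

definition based_on_standard_extension ::
  "nat \<Rightarrow> (nat \<Rightarrow> 'v literal set) \<Rightarrow> (nat \<Rightarrow> 'v literal) \<Rightarrow> (nat \<Rightarrow> 'v literal set)
     \<Rightarrow> (nat \<Rightarrow> 'v literal set) \<Rightarrow> bool" where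
  "based_on_standard_extension m D x U E \<longleftrightarrow>
     (\<forall>i\<in>{1..m}. E i \<subseteq> D i) \<and>
     E 1 = {x 1} \<and>
     (\<forall>i. 2 \<le> i \<and> i \<le> m - 1 \<longrightarrow> E i = {x i, neg (x (i - 1))} \<union> U i) \<and>
     E m = {neg (x (m - 1))} \<union> U m \<and>
     U 2 = {} \<and>
     (\<forall>j. 3 \<le> j \<and> j \<le> m \<longrightarrow> U j \<subseteq> {neg (x k) | k. 1 \<le> k \<and> k \<le> j - 2})"

end

theory Submission
  imports Defs
begin

text \<open>A tuple without complementary pairs must start with \<open>x\<^sub>1\<close>. Since \<open>E\<^sub>i\<close> offers only \<open>x\<^sub>i\<close>
  and negations of earlier \<open>x\<^sub>k\<close>, the tuple is forced to select \<open>x\<^sub>1, \<dots>, x\<^bsub>m-1\<^esub>\<close> in turn;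
  but every literal of \<open>E\<^sub>m\<close> is the negation of one of these.\<close>

lemma complementary_neg: "complementary l (neg l)"
  by (cases l) (auto simp: complementary_def)

text \<open>Brings the first, middle and last clauses to one shape fit for strong induction:
  \<open>neg (x (i - 1))\<close> and the literals of \<open>U i\<close> both count as negations of
  an earlier \<open>x k\<close>. The conjunct \<open>i < m\<close> records that the last clause
  contributes no literal \<open>x m\<close>.\<close>

lemma based_on_standard_extension_literal:
  assumes "m \<ge> 2" and ext: "based_on_standard_extension m D x U E"
    and i: "1 \<le> i" "i \<le> m" and l: "l \<in> E i"
  shows "(i < m \<and> l = x i) \<or> (\<exists>k\<ge>1. k < i \<and> l = neg (x k))"
proof (cases "i = 1")
  case True
  then show ?thesis
    using assms by (simp add: based_on_standard_extension_def)
next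
  case False
  with i have "i \<ge> 2" by simp
  have U: "\<exists>k\<ge>1. k < i \<and> l' = neg (x k)" if l': "l' \<in> U i" for l'
  proof -
    \<comment> \<open>\<open>U 2\<close> is empty, and the bound on \<open>U i\<close> is only given
      from 3 on.\<close>
    have "i \<noteq> 2"
      using ext l' by (auto simp: based_on_standard_extension_def)
    with \<open>i \<ge> 2\<close> have "3 \<le> i" by simp
    then have "l' \<in> {neg (x k) | k. 1 \<le> k \<and> k \<le> i - 2}"
      using ext i l' unfolding based_on_standard_extension_def by blast
    then obtain k where k: "1 \<le> k" "k \<le> i - 2" "l' = neg (x k)" by blast
    with \<open>3 \<le> i\<close> have "k < i" by linarith
    with k show ?thesis by blast
  qed
  have "(i < m \<and> l = x i) \<or> l = neg (x (i - 1)) \<or> l \<in> U i"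
  proof (cases "i = m")
    case True
    then show ?thesis
      using ext l by (auto simp: based_on_standard_extension_def)
  next
    case False
    with i have "i < m" "i \<le> m - 1" by simp_all
    moreover from this have "E i = {x i, neg (x (i - 1))} \<union> U i"
      using ext \<open>i \<ge> 2\<close> unfolding based_on_standard_extension_def by blast
    ultimately show ?thesis using l by blast
  qed
  moreover have "1 \<le> i - 1" "i - 1 < i" using \<open>i \<ge> 2\<close> by simp_all
  ultimately show ?thesis using U by blast
qed

theorem theorem4p1:
  fixes m :: nat
    and D E U :: "nat \<Rightarrow> 'v literal set"
    and x :: "nat \<Rightarrow> 'v literal"
  assumes "m \<ge> 2"
    and "\<forall>i\<in>{1..m}. clause (D i)"
    and "based_on_standard_extension m D x U E"
  shows "standard_contradiction m E"
  unfolding standard_contradiction_def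
proof (intro conjI ballI)
  fix i assume "i \<in> {1..m}"
  with assms(2,3) show "clause (E i)"
    unfolding clause_def based_on_standard_extension_def by (meson finite_subset)
next
  fix p assume p: "p \<in> (\<Pi>\<^sub>E i\<in>{1..m}. E i)"
  show "\<exists>i\<in>{1..m}. \<exists>j\<in>{1..m}. complementary (p i) (p j)"
  proof (rule ccontr)
    assume no: "\<not> ?thesis"
    \<comment> \<open>Carrying \<open>i < m\<close> in the claim makes its instance at
      \<open>m\<close> absurd, which ends the proof.\<close>
    have forced: "i < m \<and> p i = x i" if "1 \<le> i" "i \<le> m" for i
      using that
    proof (induction i rule: less_induct)
      case (less i)
      then have "p i \<in> E i" using p by auto
      from based_on_standard_extension_literal[OF assms(1,3) less.prems this]
      show ?case
      proof
        \<comment> \<open>The other disjunct is the goal itself. Here the induction hypothesis at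
          \<open>k\<close> turns \<open>x k\<close> into \<open>p k\<close>, so \<open>p k\<close>
          and \<open>p i\<close> clash.\<close>
        assume "\<exists>k\<ge>1. k < i \<and> p i = neg (x k)"
        then obtain k where k: "k \<ge> 1" "k < i" "p i = neg (x k)" by blast
        with less have "p i = neg (p k)" "k \<in> {1..m}" "i \<in> {1..m}" by auto
        then show ?case using no complementary_neg by metis
      qed
    qed
    from forced[of m] \<open>m \<ge> 2\<close> show False by simp
  qed
qed

end
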